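(* Let $m,n$ be positive integers with $m>n$, $m$ even and $n$ odd. Let $\mathsf S^h_{m,n}$ be the unit sphere of the norm $|||\cdot|||_{m,n}$ on $\mathbb R^3$ and let $\pi_{ac}:\mathbb R^3\to\mathbb R^2$, $\pi_{ac}(a,b,c)=(a,c)$. Then $$\pi_{ac}(\mathsf S^h_{m,n})=\{(a,c)\in[-1,1]^2: |a+c|\le 1\}.$$
   Context: For $(a,b,c)\in\mathbb R^3$, $|||(a,b,c)|||_{m,n}=\sup\{|ax^m+bx^{m-n}y^n+cy^m| : (x,y)\in[-1,1]^2\}$, and $\mathsf S^h_{m,n}=\{(a,b,c)\in\mathbb R^3: |||(a,b,c)|||_{m,n}=1\}$. *)

theory Defs
  imports "HOL-Analysis.Analysis"
begin

(* A triple (a, b, c) stands for the trinomial a x^m + b x^(m-n) y^n + c y^m.  The exponent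
   m - n is truncated subtraction on nat, so the definitions are meant for n <= m only.
   The supremum runs over a nonempty set that is bounded above (continuous function on a
   compact square), so the real-valued SUP is the true supremum. *)

definition trinomial_norm :: "nat \<Rightarrow> nat \<Rightarrow> real \<times> real \<times> real \<Rightarrow> real" where
  "trinomial_norm m n = (\<lambda>(a, b, c).
     SUP (x, y) \<in> {-1..1} \<times> {-1..1}. \<bar>a * x ^ m + b * x ^ (m - n) * y ^ n + c * y ^ m\<bar>)"

definition trinomial_sphere :: "nat \<Rightarrow> nat \<Rightarrow> (real \<times> real \<times> real) set" where
  "trinomial_sphere m n = {p. trinomial_norm m n p = 1}"

definition proj_ac :: "real \<times> real \<times> real \<Rightarrow> real \<times> real" where
  "proj_ac = (\<lambda>(a, b, c). (a, c))"

end

theory Submission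
  imports Defs
begin

text \<open>Evaluating the trinomial at \<open>(1, 0)\<close>, \<open>(0, 1)\<close> and \<open>(1, \<plusminus>1)\<close> gives the necessary conditions;
  since \<open>n\<close> is odd and \<open>m\<close> even, the last two values are \<open>a + c \<plusminus> b\<close>. Conversely, for such
  \<open>(a, c)\<close> the norm of \<open>(a, b, c)\<close> is Lipschitz in \<open>b\<close>, at most 1 at \<open>b = 0\<close> and at least 1 at
  \<open>b = 1 - a - c\<close>, so the intermediate value theorem yields a point of the sphere.\<close>

lemma abs_power_le_one:
  fixes x :: "'a::linordered_idom"
  assumes "\<bar>x\<bar> \<le> 1"
  shows "\<bar>x ^ k\<bar> \<le> 1"
  using assms by (simp add: power_abs power_le_one)

lemma abs_mult_le_left:
  fixes u v :: "'a::linordered_idom"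
  assumes "\<bar>v\<bar> \<le> 1"
  shows "\<bar>u * v\<bar> \<le> \<bar>u\<bar>"
  using assms by (simp add: abs_mult mult_left_le)

lemma abs_mixed_power_le:
  fixes b x y :: "'a::linordered_idom"
  assumes "\<bar>x\<bar> \<le> 1" "\<bar>y\<bar> \<le> 1"
  shows "\<bar>b * x ^ j * y ^ k\<bar> \<le> \<bar>b\<bar>"
  using abs_mult_le_left[of "y ^ k" "b * x ^ j"] abs_mult_le_left[of "x ^ j" b] assms
  by (meson abs_power_le_one order_trans)

text \<open>On the square the trinomial is at most
  \<open>\<bar>a\<bar> + \<bar>b\<bar> + \<bar>c\<bar>\<close>, so the set is bounded above and the
  real-valued \<open>SUP\<close> really dominates each point value.\<close>

lemma abs_trinomial_le_norm:
  assumes "\<bar>x\<bar> \<le> 1" "\<bar>y\<bar> \<le> 1"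
  shows "\<bar>a * x ^ m + b * x ^ (m - n) * y ^ n + c * y ^ m\<bar> \<le> trinomial_norm m n (a, b, c)"
proof -
  let ?f = "\<lambda>(x, y). \<bar>a * x ^ m + b * x ^ (m - n) * y ^ n + c * y ^ m\<bar>"
  have "?f p \<le> \<bar>a\<bar> + \<bar>b\<bar> + \<bar>c\<bar>" if p: "p \<in> {-1..1} \<times> {-1..1}" for p
  proof -
    obtain u v where uv: "p = (u, v)" "\<bar>u\<bar> \<le> 1" "\<bar>v\<bar> \<le> 1"
      using p by (auto simp: abs_le_iff)
    have "\<bar>a * u ^ m\<bar> \<le> \<bar>a\<bar>" "\<bar>c * v ^ m\<bar> \<le> \<bar>c\<bar>"
      using uv by (auto intro!: abs_mult_le_left abs_power_le_one)
    with abs_mixed_power_le[OF uv(2,3), of b "m - n" n] show ?thesis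
      unfolding uv(1) prod.case by linarith
  qed
  then have "bdd_above (?f ` ({-1..1} \<times> {-1..1}))"
    by (intro bdd_aboveI2)
  from cSUP_upper[OF _ this, of "(x, y)"] assms show ?thesis
    by (simp add: trinomial_norm_def abs_le_iff minus_le_iff)
qed

lemma trinomial_norm_least:
  assumes "\<And>x y. \<bar>x\<bar> \<le> 1 \<Longrightarrow> \<bar>y\<bar> \<le> 1 \<Longrightarrow> \<bar>a * x ^ m + b * x ^ (m - n) * y ^ n + c * y ^ m\<bar> \<le> C"
  shows "trinomial_norm m n (a, b, c) \<le> C"
  unfolding trinomial_norm_def prod.case
  by (rule cSUP_least) (auto intro!: assms simp: abs_le_iff)

text \<open>Replacing \<open>b'\<close> by \<open>b\<close> adds
  \<open>(b - b') * x ^ (m - n) * y ^ n\<close>, which is at most \<open>\<bar>b - b'\<bar>\<close>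
  in absolute value on the square. This supplies the continuity for the intermediate value
  theorem.\<close>

lemma trinomial_norm_lipschitz_middle:
  "1-lipschitz_on S (\<lambda>b. trinomial_norm m n (a, b, c))"
proof -
  have le: "trinomial_norm m n (a, b, c) \<le> trinomial_norm m n (a, b', c) + \<bar>b - b'\<bar>" for b b'
  proof (rule trinomial_norm_least)
    fix x y :: real
    assume xy: "\<bar>x\<bar> \<le> 1" "\<bar>y\<bar> \<le> 1"
    show "\<bar>a * x ^ m + b * x ^ (m - n) * y ^ n + c * y ^ m\<bar>
      \<le> trinomial_norm m n (a, b', c) + \<bar>b - b'\<bar>"
      using abs_trinomial_le_norm[OF xy, of a m b' n c] abs_mixed_power_le[OF xy, of "b - b'" "m - n" n]
      by (simp add: left_diff_distrib)
  qed
  show ?thesis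
    using le by (intro lipschitz_onI) (smt (verit) dist_real_def)+
qed

text \<open>For even \<open>m\<close> both \<open>x ^ m\<close> and \<open>y ^ m\<close> lie in
  \<open>[0, 1]\<close>, so a linear form in two such numbers has to be bounded.\<close>

lemma trinomial_norm_middle_zero_le:
  assumes "even m" "\<bar>a\<bar> \<le> 1" "\<bar>c\<bar> \<le> 1" "\<bar>a + c\<bar> \<le> 1"
  shows "trinomial_norm m n (a, 0, c) \<le> 1"
proof (rule trinomial_norm_least)
  fix x y :: real
  assume xy: "\<bar>x\<bar> \<le> 1" "\<bar>y\<bar> \<le> 1"
  \<comment> \<open>Summation by parts: the weights \<open>s\<close> and \<open>t - s\<close> are
    nonnegative with sum \<open>t \<le> 1\<close>, and their coefficients \<open>p + q\<close> and
    \<open>q\<close> are bounded by 1.\<close>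
  have key: "\<bar>p * s + q * t\<bar> \<le> 1"
    if "0 \<le> s" "s \<le> t" "t \<le> 1" "\<bar>q\<bar> \<le> 1" "\<bar>p + q\<bar> \<le> 1" for p q s t :: real
  proof -
    have "\<bar>(p + q) * s\<bar> \<le> s" "\<bar>q * (t - s)\<bar> \<le> t - s"
      using that by (auto simp: abs_mult mult_left_le_one_le)
    moreover have "p * s + q * t = (p + q) * s + q * (t - s)"
      by (simp add: algebra_simps)
    ultimately show ?thesis
      using that by linarith
  qed
  have "0 \<le> x ^ m" "0 \<le> y ^ m"
    using \<open>even m\<close> by (auto simp: zero_le_even_power)
  moreover have "x ^ m \<le> 1" "y ^ m \<le> 1"
    using xy abs_power_le_one abs_le_D1 by blast+
  ultimately show "\<bar>a * x ^ m + 0 * x ^ (m - n) * y ^ n + c * y ^ m\<bar> \<le> 1"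
    using key[of "x ^ m" "y ^ m" c a] key[of "y ^ m" "x ^ m" a c] assms
    by (cases "x ^ m \<le> y ^ m") (auto simp: add.commute)
qed

theorem theorem3p2:
  fixes m n :: nat
  assumes "n > 0" and "m > n" and "even m" and "odd n"
  shows "proj_ac ` trinomial_sphere m n
    = {(a, c). (a, c) \<in> {-1..1} \<times> {-1..1} \<and> \<bar>a + c\<bar> \<le> 1}"
proof (intro equalityI subsetI)
  fix p
  assume "p \<in> proj_ac ` trinomial_sphere m n"
  then obtain a b c where p: "p = (a, c)" and N: "trinomial_norm m n (a, b, c) = 1"
    by (auto simp: proj_ac_def trinomial_sphere_def)
  \<comment> \<open>Since \<open>0 ^ 0 = 1\<close>, the middle term vanishes at
    \<open>(1, 0)\<close> because \<open>n > 0\<close>, and at \<open>(0, 1)\<close> because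
    \<open>m > n\<close>.\<close>
  have "\<bar>a\<bar> \<le> 1" "\<bar>c\<bar> \<le> 1" "\<bar>a + b + c\<bar> \<le> 1" "\<bar>a - b + c\<bar> \<le> 1"
    using abs_trinomial_le_norm[of 1 0 a m b n c] abs_trinomial_le_norm[of 0 1 a m b n c]
      abs_trinomial_le_norm[of 1 1 a m b n c] abs_trinomial_le_norm[of 1 "-1" a m b n c] assms N
    by (simp_all add: power_0_left)
  \<comment> \<open>The unknown \<open>b\<close> drops out: \<open>a + c\<close> is the mean of
    \<open>a + b + c\<close> and \<open>a - b + c\<close>.\<close>
  then show "p \<in> {(a, c). (a, c) \<in> {-1..1} \<times> {-1..1} \<and> \<bar>a + c\<bar> \<le> 1}"
    unfolding p by auto
next
  fix p :: "real \<times> real"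
  assume "p \<in> {(a, c). (a, c) \<in> {-1..1} \<times> {-1..1} \<and> \<bar>a + c\<bar> \<le> 1}"
  then obtain a c where p: "p = (a, c)" and ac: "\<bar>a\<bar> \<le> 1" "\<bar>c\<bar> \<le> 1" "\<bar>a + c\<bar> \<le> 1"
    by (auto simp: abs_le_iff)
  \<comment> \<open>This middle coefficient makes the value at \<open>(1, 1)\<close> equal to
    1.\<close>
  have "1 \<le> trinomial_norm m n (a, 1 - a - c, c)"
    using abs_trinomial_le_norm[of 1 1 a m "1 - a - c" n c] by simp
  moreover have "0 \<le> 1 - a - c"
    using ac by linarith
  ultimately obtain b where "trinomial_norm m n (a, b, c) = 1"
    using IVT'[of "\<lambda>b. trinomial_norm m n (a, b, c)" 0 1 "1 - a - c"]
      trinomial_norm_middle_zero_le[OF \<open>even m\<close> ac]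
      lipschitz_on_continuous_on[OF trinomial_norm_lipschitz_middle] by blast
  then show "p \<in> proj_ac ` trinomial_sphere m n"
    unfolding p by (force simp: proj_ac_def trinomial_sphere_def)
qed

end
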